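(* Let $M\in\mathbb{R}^{[n]^2\times[n]^2}$ be a degree-4 SoS-symmetric matrix and let $q$ be divisible by $4$. Then \[(q/4)!\cdot4!^{\,q/4}\cdot\sum_{\mathfrak{M}\in S^{\mathfrak{M}}}\mathfrak{M}=\sum_{\pi\in\mathbb{S}_q}\bigl(M^{\otimes q/4}\bigr)^\pi=q!\cdot\bigl(M^{\otimes q/4}\bigr)^S.\]
   Context: $M$ is degree-4 SoS-symmetric if $M[(i_1,i_2),(i_3,i_4)]$ depends only on the multiset $\{i_1,i_2,i_3,i_4\}$. Let $T[i_1,i_2,i_3,i_4]=M[(i_1,i_2),(i_3,i_4)]$ and, for $x+y=4$, $M_{x,y}\in\mathbb{R}^{[n]^x\times[n]^y}$ with $M_{x,y}[(i_1,\dots,i_x),(j_1,\dots,j_y)]=T[i_1,\dots,i_x,j_1,\dots,j_y]$. Define $M_A:=M_{3,1}\otimes M_{0,4}\otimes M_{3,1}$, $M_B:=M_{3,1}\otimes M_{1,3}$, $M_C:=M$, $M_D:=\mathrm{vec}(M)\mathrm{vec}(M)^T$ where $\mathrm{vec}(M)\in\mathbb{R}^{[n]^4}$ has entries $T[i_1,\dots,i_4]$ ($\otimes$ is the Kronecker product). For $\sigma\in\mathbb{S}_{q/2}$ let $P_\sigma\in\mathbb{R}^{[n]^{q/2}\times[n]^{q/2}}$ be the permutation matrix induced by the map $[n]^{q/2}\to[n]^{q/2}$ permuting tuple coordinates by $\sigma$, and $P:=\sum_{\sigma\in\mathbb{S}_{q/2}}P_\sigma$. Let $\mathcal{R}(a,b,c,d):=(c!^{\,2}\,2!^{\,2c})(b!\,(2a+b)!\,3!^{\,2a+2b})(d!\,(a+d)!\,4!^{\,a+2d})$,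 $\mathfrak{M}(a,b,c,d):=\frac{M_A^{\otimes a}\otimes M_B^{\otimes b}\otimes M_C^{\otimes c}\otimes M_D^{\otimes d}}{\mathcal{R}(a,b,c,d)}$, $\overline{\mathfrak{M}}(a,b,c,d):=\frac{(M_A^T)^{\otimes a}\otimes M_B^{\otimes b}\otimes M_C^{\otimes c}\otimes M_D^{\otimes d}}{\mathcal{R}(a,b,c,d)}$, and $S^{\mathfrak{M}}:=\{P\mathfrak{M}(a,b,c,d)P^T:\ 12a+8b+4c+8d=q\}\cup\{P\overline{\mathfrak{M}}(a,b,c,d)P^T:\ 12a+8b+4c+8d=q\}$ (a set; $a,b,c,d$ non-negative integers). For $B\in\mathbb{R}^{[n]^{q/2}\times[n]^{q/2}}$ indexed by $K=(k_1,\dots,k_q)\in[n]^q$ (row = first $q/2$ coordinates, column = last $q/2$), $B^\pi[K]:=B[(k_{\pi(1)},\dots,k_{\pi(q)})]$ for $\pi\in\mathbb{S}_q$ and $B^S:=\frac1{q!}\sum_{\pi\in\mathbb{S}_q}B^\pi$.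
   Formalization: In R(a,b,c,d) the factor c!^2 is corrected to c! (as printed the identity fails for n=1, M=(1), q=8: 29952 vs 40320), and S^M is read as a set of formal expressions (equal matrices from different expressions each count; barred ones only for a>0). *)

theory Defs
  imports
    "HOL-Analysis.Finite_Cartesian_Product"
    "HOL-Combinatorics.Permutations"
    "HOL-Library.Multiset"
begin

text \<open>
  The index set \<open>[n]\<close> is a finite type \<open>'n\<close>. A tuple in \<open>[n]^k\<close> is a list of length \<open>k\<close>. A matrix in
  \<open>\<real>^([n]^x \<times> [n]^y)\<close> is recorded with its arities \<open>x\<close> (\<open>row_len\<close>) and \<open>y\<close> (\<open>col_len\<close>); its entries
  are meaningful only at row tuples of length \<open>x\<close> and column tuples of length \<open>y\<close>, so equality of
  two such matrices means equality of the entries there.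
\<close>

datatype 'n tmat =
  TMat (row_len: nat) (col_len: nat) (entry: "'n list \<Rightarrow> 'n list \<Rightarrow> real")

definition tm_transpose :: "'n tmat \<Rightarrow> 'n tmat" where
  "tm_transpose A = TMat (col_len A) (row_len A) (\<lambda>I J. entry A J I)"

definition tm_scale :: "real \<Rightarrow> 'n tmat \<Rightarrow> 'n tmat" where
  "tm_scale r A = TMat (row_len A) (col_len A) (\<lambda>I J. r * entry A I J)"

definition tm_mult :: "'n tmat \<Rightarrow> 'n tmat \<Rightarrow> 'n tmat" where
  "tm_mult A B = TMat (row_len A) (col_len B)
     (\<lambda>I J. \<Sum>K | length K = col_len A. entry A I K * entry B K J)"

text \<open>Kronecker product, with \<open>[n]^x \<times> [n]^x'\<close> identified with \<open>[n]^(x+x')\<close> by concatenation.\<close>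

definition tm_kron :: "'n tmat \<Rightarrow> 'n tmat \<Rightarrow> 'n tmat" (infixr "\<otimes>\<^sub>K" 70) where
  "A \<otimes>\<^sub>K B = TMat (row_len A + row_len B) (col_len A + col_len B)
     (\<lambda>I J. entry A (take (row_len A) I) (take (col_len A) J) *
            entry B (drop (row_len A) I) (drop (col_len A) J))"

primrec tm_kron_power :: "'n tmat \<Rightarrow> nat \<Rightarrow> 'n tmat" where
  "tm_kron_power A 0 = TMat 0 0 (\<lambda>I J. 1)"
| "tm_kron_power A (Suc k) = A \<otimes>\<^sub>K tm_kron_power A k"

definition sos_symmetric4 :: "real^('n::finite \<times> 'n)^('n \<times> 'n) \<Rightarrow> bool" where
  "sos_symmetric4 M \<longleftrightarrow>
     (\<forall>i1 i2 i3 i4 j1 j2 j3 j4. {#i1, i2, i3, i4#} = {#j1, j2, j3, j4#} \<longrightarrow>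
        M $ (i1, i2) $ (i3, i4) = M $ (j1, j2) $ (j3, j4))"

text \<open>The tensor \<open>T\<close> (and hence \<open>vec(M)\<close>), evaluated at tuples of length 4.\<close>

definition tensor4 :: "real^('n::finite \<times> 'n)^('n \<times> 'n) \<Rightarrow> 'n list \<Rightarrow> real" where
  "tensor4 M K = M $ (K ! 0, K ! 1) $ (K ! 2, K ! 3)"

definition unfold4 :: "real^('n::finite \<times> 'n)^('n \<times> 'n) \<Rightarrow> nat \<Rightarrow> nat \<Rightarrow> 'n tmat" where
  "unfold4 M x y = TMat x y (\<lambda>I J. tensor4 M (I @ J))"

definition M_A :: "real^('n::finite \<times> 'n)^('n \<times> 'n) \<Rightarrow> 'n tmat" where
  "M_A M = unfold4 M 3 1 \<otimes>\<^sub>K unfold4 M 0 4 \<otimes>\<^sub>K unfold4 M 3 1"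

definition M_B :: "real^('n::finite \<times> 'n)^('n \<times> 'n) \<Rightarrow> 'n tmat" where
  "M_B M = unfold4 M 3 1 \<otimes>\<^sub>K unfold4 M 1 3"

definition M_C :: "real^('n::finite \<times> 'n)^('n \<times> 'n) \<Rightarrow> 'n tmat" where
  "M_C M = TMat 2 2 (\<lambda>I J. M $ (I ! 0, I ! 1) $ (J ! 0, J ! 1))"

definition M_D :: "real^('n::finite \<times> 'n)^('n \<times> 'n) \<Rightarrow> 'n tmat" where
  "M_D M = TMat 4 4 (\<lambda>I J. tensor4 M I * tensor4 M J)"

definition perm_mat :: "nat \<Rightarrow> (nat \<Rightarrow> nat) \<Rightarrow> 'n tmat" where
  "perm_mat m \<sigma> = TMat m m (\<lambda>I J. if I = permute_list \<sigma> J then 1 else 0)"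

definition perm_sum :: "nat \<Rightarrow> 'n tmat" where
  "perm_sum m = TMat m m (\<lambda>I J. \<Sum>\<sigma> | \<sigma> permutes {..<m}. entry (perm_mat m \<sigma>) I J)"

text \<open>
  The literature has \<open>c!\<^sup>2\<close> in place of \<open>c!\<close> in the first factor. That is a misprint: permuting the
  \<open>c\<close> copies of \<open>M_C\<close> moves their row blocks and column blocks simultaneously, which is an overcount
  by \<open>c!\<close> only. With \<open>c!\<^sup>2\<close> the identity fails already for \<open>n = 1\<close>, \<open>M = (1)\<close>, \<open>q = 8\<close>: the terms
  \<open>(a,b,c,d) = (0,0,2,0), (0,1,0,0), (0,0,0,1)\<close> would contribute \<open>9 + 16 + 1 = 26\<close>,
  whereas \<open>8! / (2! * 4!\<^sup>2) = 35 = 18 + 16 + 1\<close>.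
\<close>

definition normR :: "nat \<Rightarrow> nat \<Rightarrow> nat \<Rightarrow> nat \<Rightarrow> real" where
  "normR a b c d =
     (fact c * fact 2 ^ (2 * c)) *
     (fact b * fact (2 * a + b) * fact 3 ^ (2 * a + 2 * b)) *
     (fact d * fact (a + d) * fact 4 ^ (a + 2 * d))"

definition frakM ::
  "real^('n::finite \<times> 'n)^('n \<times> 'n) \<Rightarrow> nat \<Rightarrow> nat \<Rightarrow> nat \<Rightarrow> nat \<Rightarrow> 'n tmat" where
  "frakM M a b c d = tm_scale (1 / normR a b c d)
     (tm_kron_power (M_A M) a \<otimes>\<^sub>K tm_kron_power (M_B M) b \<otimes>\<^sub>K
      tm_kron_power (M_C M) c \<otimes>\<^sub>K tm_kron_power (M_D M) d)"

definition frakM_bar ::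
  "real^('n::finite \<times> 'n)^('n \<times> 'n) \<Rightarrow> nat \<Rightarrow> nat \<Rightarrow> nat \<Rightarrow> nat \<Rightarrow> 'n tmat" where
  "frakM_bar M a b c d = tm_scale (1 / normR a b c d)
     (tm_kron_power (tm_transpose (M_A M)) a \<otimes>\<^sub>K tm_kron_power (M_B M) b \<otimes>\<^sub>K
      tm_kron_power (M_C M) c \<otimes>\<^sub>K tm_kron_power (M_D M) d)"

text \<open>
  The elements of \<open>S\<close> are formal expressions, not their values: for special \<open>M\<close> (e.g. \<open>n = 1\<close>)
  the matrices of different expressions may coincide, and each must still be counted. The
  expressions \<open>frakM M a b c d\<close> and \<open>frakM_bar M a b c d\<close> are the same one when \<open>a = 0\<close>
  and then count once, whence the restriction \<open>a > 0\<close> on the barred ones.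
\<close>

datatype frak = Frak nat nat nat nat | FrakBar nat nat nat nat

definition frak_set :: "nat \<Rightarrow> frak set" where
  "frak_set q =
     {Frak a b c d | a b c d. 12 * a + 8 * b + 4 * c + 8 * d = q} \<union>
     {FrakBar a b c d | a b c d. 12 * a + 8 * b + 4 * c + 8 * d = q \<and> a > 0}"

lemma frakM_bar_0: "frakM_bar M 0 b c d = frakM M 0 b c d"
  by (simp add: frakM_bar_def frakM_def)

fun frak_core :: "real^('n::finite \<times> 'n)^('n \<times> 'n) \<Rightarrow> frak \<Rightarrow> 'n tmat" where
  "frak_core M (Frak a b c d) = frakM M a b c d"
| "frak_core M (FrakBar a b c d) = frakM_bar M a b c d"

definition frak_mat :: "real^('n::finite \<times> 'n)^('n \<times> 'n) \<Rightarrow> nat \<Rightarrow> frak \<Rightarrow> 'n tmat" where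
  "frak_mat M q X =
     tm_mult (tm_mult (perm_sum (q div 2)) (frak_core M X)) (tm_transpose (perm_sum (q div 2)))"

text \<open>\<open>B^\<pi>\<close>: the row index followed by the column index is permuted as one tuple of length
  \<open>row_len B + col_len B\<close>; \<open>permute_list \<pi> K\<close> is \<open>(k_\<pi>(1), k_\<pi>(2), \<dots>)\<close>.\<close>

definition tm_permute :: "(nat \<Rightarrow> nat) \<Rightarrow> 'n tmat \<Rightarrow> 'n tmat" where
  "tm_permute \<pi> B = TMat (row_len B) (col_len B)
     (\<lambda>I J. let K = permute_list \<pi> (I @ J)
            in entry B (take (row_len B) K) (drop (row_len B) K))"

definition tm_symmetrize :: "'n tmat \<Rightarrow> 'n tmat" where
  "tm_symmetrize B = TMat (row_len B) (col_len B)
     (\<lambda>I J. 1 / fact (row_len B + col_len B) *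
            (\<Sum>\<pi> | \<pi> permutes {..<row_len B + col_len B}. entry (tm_permute \<pi> B) I J))"

end

theory Submission
  imports Defs "HOL-Combinatorics.Multiset_Permutations"
begin

text \<open>
  Both sides are multiples of the sum, over all partitions of the \<open>q\<close> index positions into blocks of
  size 4, of the product of the entries of \<open>T\<close> at the blocks. A partition into \<open>k = q/4\<close> blocks is
  classified by the numbers \<open>n\<^sub>r\<close> of blocks with \<open>r\<close> row positions and \<open>4 - r\<close> column positions.
  Since there are as many rows as columns, \<open>\<Sum>n\<^sub>r = k\<close> and \<open>\<Sum>r n\<^sub>r = 2k\<close>, and the solutions of these two
  equations are exactly the type counts of the expressions in \<open>S\<close>: \<open>n\<^sub>0 \<ge> n\<^sub>4\<close> gives \<open>frakM\<close> and
  \<open>n\<^sub>0 < n\<^sub>4\<close> gives \<open>frakM_bar\<close>. Permuting rows and columns of such an expression independently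
  reaches each partition of its type equally often, namely \<open>\<Prod>n\<^sub>r!\<close> times one factor \<open>r! (4 - r)!\<close>
  for each block, which is \<open>normR\<close>. It is convenient to order the blocks, since the sequences of
  types with given counts number \<open>k! / \<Prod>n\<^sub>r!\<close>.
\<close>

section \<open>Sums over orderings of a finite set\<close>

text \<open>Cutting an ordering of \<open>Q\<close> after \<open>r\<close> entries is a bijection:
  the cut determines the set \<open>A\<close> of the first \<open>r\<close> entries, an ordering of
  \<open>A\<close> and an ordering of the rest.\<close>

lemma sum_permutations_of_set_split:
  assumes "finite Q" "r \<le> card Q"
  shows "(\<Sum>l\<in>permutations_of_set Q. f (take r l) (drop r l))
       = (\<Sum>A | A \<subseteq> Q \<and> card A = r. \<Sum>l\<in>permutations_of_set A.
            \<Sum>l'\<in>permutations_of_set (Q - A). (f l l' :: real))"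
proof -
  let ?S = "{A. A \<subseteq> Q \<and> card A = r}"
  have fin: "finite ?S" using assms(1) by simp
  have "(\<Sum>A\<in>?S. \<Sum>l\<in>permutations_of_set A. \<Sum>l'\<in>permutations_of_set (Q - A). f l l')
      = (\<Sum>(A, l, l')\<in>Sigma ?S (\<lambda>A. permutations_of_set A \<times> permutations_of_set (Q - A)). f l l')"
    by (subst sum.Sigma[symmetric]) (auto simp: assms(1) sum.cartesian_product)
  also have "\<dots> = (\<Sum>l\<in>permutations_of_set Q. f (take r l) (drop r l))"
  proof (rule sum.reindex_bij_witness[where i = "\<lambda>l. (set (take r l), take r l, drop r l)"
        and j = "\<lambda>(A, l, l'). l @ l'"])
    fix a assume a: "a \<in> Sigma ?S (\<lambda>A. permutations_of_set A \<times> permutations_of_set (Q - A))"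
    obtain A l l' where [simp]: "a = (A, l, l')" by (cases a)
    from a have "set l = A" "distinct l" "card A = r" "set l' = Q - A" "distinct l'" "A \<subseteq> Q"
      by (auto simp: permutations_of_set_def)
    then show "(set (take r (case a of (A, l, l') \<Rightarrow> l @ l')), take r (case a of (A, l, l') \<Rightarrow> l @ l'),
         drop r (case a of (A, l, l') \<Rightarrow> l @ l')) = a"
      and "(case a of (A, l, l') \<Rightarrow> l @ l') \<in> permutations_of_set Q"
      and "f (take r (case a of (A, l, l') \<Rightarrow> l @ l')) (drop r (case a of (A, l, l') \<Rightarrow> l @ l')) =
         (case a of (A, l, l') \<Rightarrow> f l l')"
      using distinct_card[of l] by (auto intro!: permutations_of_setI)
  next
    fix l assume "l \<in> permutations_of_set Q"
    then have l: "set l = Q" "distinct l" by (auto simp: permutations_of_set_def)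
    have disj: "set (take r l) \<inter> set (drop r l) = {}"
      using l(2) by (simp add: set_take_disj_set_drop_if_distinct)
    have un: "set (take r l) \<union> set (drop r l) = Q"
      using l(1) by (metis append_take_drop_id set_append)
    have "r \<le> length l" using assms(2) l distinct_card by force
    then have "card (set (take r l)) = r" using l by (simp add: distinct_card)
    then show "(set (take r l), take r l, drop r l)
        \<in> Sigma ?S (\<lambda>A. permutations_of_set A \<times> permutations_of_set (Q - A))"
      using l un disj by (auto intro!: permutations_of_setI)
  qed auto
  finally show ?thesis by simp
qed

text \<open>On a list without repetitions distinct permutations give distinct rearrangements, and
  every ordering of the underlying set is such a rearrangement.\<close>

lemma sum_permutes_eq_sum_permutations_of_set:
  assumes "distinct xs"
  shows "(\<Sum>\<sigma> | \<sigma> permutes {..<length xs}. f (permute_list \<sigma> xs))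
       = (\<Sum>l\<in>permutations_of_set (set xs). (f l :: real))"
proof -
  have "bij_betw (\<lambda>\<sigma>. permute_list \<sigma> xs) {\<sigma>. \<sigma> permutes {..<length xs}} (permutations_of_set (set xs))"
    unfolding bij_betw_def
  proof (intro conjI inj_onI set_eqI iffI)
    fix \<sigma> \<tau> assume *: "\<sigma> \<in> {\<sigma>. \<sigma> permutes {..<length xs}}" "\<tau> \<in> {\<sigma>. \<sigma> permutes {..<length xs}}"
      and eq: "permute_list \<sigma> xs = permute_list \<tau> xs"
    show "\<sigma> = \<tau>"
    proof
      fix i
      show "\<sigma> i = \<tau> i"
      proof (cases "i < length xs")
        case True
        have "xs ! \<sigma> i = xs ! \<tau> i"
          using eq True * by (metis mem_Collect_eq permute_list_nth)
        moreover have "\<sigma> i < length xs" "\<tau> i < length xs"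
          using * True permutes_in_image[of _ "{..<length xs}"] by auto
        ultimately show ?thesis using assms nth_eq_iff_index_eq by blast
      next
        case False
        then show ?thesis using * by (auto simp: permutes_def)
      qed
    qed
  next
    fix l assume "l \<in> (\<lambda>\<sigma>. permute_list \<sigma> xs) ` {\<sigma>. \<sigma> permutes {..<length xs}}"
    then show "l \<in> permutations_of_set (set xs)"
      using assms by (auto intro!: permutations_of_setI)
  next
    fix l assume "l \<in> permutations_of_set (set xs)"
    then have "mset l = mset xs"
      using assms set_eq_iff_mset_eq_distinct permutations_of_setD by metis
    then obtain p where "p permutes {..<length xs}" "permute_list p xs = l"
      by (rule mset_eq_permutation)
    then show "l \<in> (\<lambda>\<sigma>. permute_list \<sigma> xs) ` {\<sigma>. \<sigma> permutes {..<length xs}}" by auto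
  qed
  then show ?thesis by (rule sum.reindex_bij_betw)
qed

lemma list_split4:
  assumes "length l = i + j + m + n"
  shows "\<exists>a b c d. l = a @ b @ c @ d \<and> length a = i \<and> length b = j \<and> length c = m \<and> length d = n"
proof -
  have "l = take i l @ take j (drop i l) @ take m (drop j (drop i l)) @ drop m (drop j (drop i l))"
    by (simp only: append_take_drop_id)
  moreover have "length (take i l) = i" "length (take j (drop i l)) = j"
    "length (take m (drop j (drop i l))) = m" "length (drop m (drop j (drop i l))) = n"
    using assms by auto
  ultimately show ?thesis by blast
qed

section \<open>Ordered partitions into typed blocks of size four\<close>

text \<open>A block type is the number \<open>r\<close> of its row indices; it has \<open>4 - r\<close> column indices.\<close>

primrec block_prod :: "('n list \<Rightarrow> real) \<Rightarrow> nat list \<Rightarrow> 'n list \<Rightarrow> 'n list \<Rightarrow> real" where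
  "block_prod T [] I J = 1"
| "block_prod T (r # s) I J =
     T (take r I @ take (4 - r) J) * block_prod T s (drop r I) (drop (4 - r) J)"

text \<open>
  Sums over the ordered partitions of a set \<open>Q\<close> of positions into blocks \<open>A\<close> of weight \<open>w A\<close>;
  \<open>R\<close> is the set of row positions.
\<close>

primrec typed_partition_sum :: "('a set \<Rightarrow> real) \<Rightarrow> 'a set \<Rightarrow> nat list \<Rightarrow> 'a set \<Rightarrow> real" where
  "typed_partition_sum w R [] Q = (if Q = {} then 1 else 0)"
| "typed_partition_sum w R (r # s) Q =
     (\<Sum>A | A \<subseteq> Q \<and> card A = 4 \<and> card (A \<inter> R) = r. w A * typed_partition_sum w R s (Q - A))"

primrec partition_sum :: "('a set \<Rightarrow> real) \<Rightarrow> nat \<Rightarrow> 'a set \<Rightarrow> real" where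
  "partition_sum w 0 Q = (if Q = {} then 1 else 0)"
| "partition_sum w (Suc k) Q =
     (\<Sum>A | A \<subseteq> Q \<and> card A = 4. w A * partition_sum w k (Q - A))"

text \<open>Every block \<open>A\<close> has exactly one type \<open>card (A \<inter> R)\<close>, at
  most 4, so ordered partitions can be grouped by their sequence of types.\<close>

lemma partition_sum_eq_sum_typed:
  assumes "finite Q"
  shows "partition_sum w k Q =
    (\<Sum>s | set s \<subseteq> {..4} \<and> length s = k. typed_partition_sum w R s Q)"
  using assms
proof (induction k arbitrary: Q)
  case 0
  have "{s. set s \<subseteq> {..4::nat} \<and> length s = 0} = {[]}" by auto
  then show ?case by simp
next
  case (Suc k)
  let ?L = "\<lambda>k. {s. set s \<subseteq> {..4::nat} \<and> length s = k}"
  have "partition_sum w (Suc k) Q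
      = (\<Sum>A | A \<subseteq> Q \<and> card A = 4. \<Sum>s\<in>?L k. w A * typed_partition_sum w R s (Q - A))"
    using Suc by (simp add: sum_distrib_left)
  also have "\<dots> = (\<Sum>r\<le>4. \<Sum>A | A \<in> {A. A \<subseteq> Q \<and> card A = 4} \<and> card (A \<inter> R) = r.
                   \<Sum>s\<in>?L k. w A * typed_partition_sum w R s (Q - A))"
  proof (rule sum.group[symmetric])
    show "(\<lambda>A. card (A \<inter> R)) ` {A. A \<subseteq> Q \<and> card A = 4} \<subseteq> {..4}"
      using Suc.prems by (auto, metis card_mono finite_subset inf_le1)
  qed (use Suc.prems in auto)
  also have "\<dots> = (\<Sum>r\<le>4. \<Sum>s\<in>?L k. typed_partition_sum w R (r # s) Q)"
    by (intro sum.cong refl, subst sum.swap) (simp add: conj_assoc)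
  also have "\<dots> = (\<Sum>(r, s)\<in>{..4} \<times> ?L k. typed_partition_sum w R (r # s) Q)"
    by (rule sum.cartesian_product)
  also have "\<dots> = (\<Sum>s\<in>?L (Suc k). typed_partition_sum w R s Q)"
    by (rule sum.reindex_bij_witness[where i = "\<lambda>s. (hd s, tl s)" and j = "\<lambda>(r, s). r # s"])
      (auto simp: length_Suc_conv)
  finally show ?case .
qed

text \<open>The blocks of a partition share out the elements of \<open>Q \<inter> R\<close>, so the
  types must add up to their number; otherwise the sum is over no partition at all.\<close>

lemma typed_partition_sum_eq_0:
  assumes "finite Q" "sum_list s \<noteq> card (Q \<inter> R)"
  shows "typed_partition_sum w R s Q = 0"
  using assms
proof (induction s arbitrary: Q)
  case (Cons r s)
  have "typed_partition_sum w R s (Q - A) = 0"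
    if "A \<subseteq> Q \<and> card A = 4 \<and> card (A \<inter> R) = r" for A
  proof (rule Cons.IH)
    have "(Q - A) \<inter> R = Q \<inter> R - A \<inter> R" by auto
    moreover have "card (Q \<inter> R - A \<inter> R) = card (Q \<inter> R) - card (A \<inter> R)"
      "card (A \<inter> R) \<le> card (Q \<inter> R)"
      using that Cons.prems(1) by (auto intro!: card_Diff_subset card_mono intro: finite_subset)
    ultimately show "sum_list s \<noteq> card ((Q - A) \<inter> R)"
      using that Cons.prems(2) by auto
  qed (use Cons.prems in auto)
  then show ?case by simp
qed auto

text \<open>Exchanging the first two blocks is an involution that preserves the product of weights
  and the remaining set.\<close>

lemma typed_partition_sum_swap:
  assumes "finite Q"
  shows "typed_partition_sum w R (r # r' # s) Q = typed_partition_sum w R (r' # r # s) Q"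
proof -
  let ?S = "\<lambda>r r'. Sigma {A. A \<subseteq> Q \<and> card A = 4 \<and> card (A \<inter> R) = r}
     (\<lambda>A. {B. B \<subseteq> Q - A \<and> card B = 4 \<and> card (B \<inter> R) = r'})"
  have expand: "typed_partition_sum w R (r # r' # s) Q
      = (\<Sum>(A, B)\<in>?S r r'. w A * (w B * typed_partition_sum w R s (Q - A - B)))" for r r'
    using assms by (simp add: sum.Sigma[symmetric] sum_distrib_left)
  have comm: "Q - A - B = Q - B - A" for A B by auto
  show ?thesis
    unfolding expand
    by (rule sum.reindex_bij_witness[where i = "\<lambda>(A, B). (B, A)" and j = "\<lambda>(A, B). (B, A)"])
      (auto simp: comm mult.left_commute)
qed

lemma typed_partition_sum_move:
  assumes "finite Q"
  shows "typed_partition_sum w R (t @ r # s) Q = typed_partition_sum w R (r # t @ s) Q"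
  using assms
proof (induction t arbitrary: Q)
  case (Cons a t)
  have "typed_partition_sum w R ((a # t) @ r # s) Q = typed_partition_sum w R (a # r # t @ s) Q"
    using Cons by simp
  then show ?case using typed_partition_sum_swap[OF Cons.prems] by simp
qed simp

text \<open>Adjacent swaps generate all rearrangements of the type sequence. Hence all sequences
  with the same counts contribute equally, which later brings in the number of these
  sequences.\<close>

lemma typed_partition_sum_mset_cong:
  assumes "finite Q" "mset s = mset s'"
  shows "typed_partition_sum w R s Q = typed_partition_sum w R s' Q"
  using assms
proof (induction s arbitrary: s' Q)
  case (Cons r s)
  have "r \<in> set s'" using Cons.prems(2) by (metis list.set_intros(1) set_mset_mset)
  then obtain t u where s': "s' = t @ r # u" by (meson split_list)
  then have "mset s = mset (t @ u)" using Cons.prems(2) by simp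
  then have "typed_partition_sum w R (r # s) Q = typed_partition_sum w R (r # t @ u) Q"
    using Cons.IH[of _ "t @ u"] Cons.prems(1) by simp
  then show ?case using typed_partition_sum_move Cons.prems(1) s' by metis
qed simp

text \<open>A block of type \<open>r\<close> is uniquely the union of its row part \<open>B\<close>
  and its column part \<open>C\<close>.\<close>

lemma sum_blocks_split:
  assumes "finite Q" "r \<le> 4"
  shows "(\<Sum>A | A \<subseteq> Q \<and> card A = 4 \<and> card (A \<inter> R) = r. g A)
    = (\<Sum>B | B \<subseteq> Q \<inter> R \<and> card B = r. \<Sum>C | C \<subseteq> Q - R \<and> card C = 4 - r. (g (B \<union> C) :: real))"
proof -
  have "(\<Sum>B | B \<subseteq> Q \<inter> R \<and> card B = r. \<Sum>C | C \<subseteq> Q - R \<and> card C = 4 - r. g (B \<union> C))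
     = (\<Sum>(B, C)\<in>{B. B \<subseteq> Q \<inter> R \<and> card B = r} \<times> {C. C \<subseteq> Q - R \<and> card C = 4 - r}. g (B \<union> C))"
    by (simp add: sum.cartesian_product)
  also have "\<dots> = (\<Sum>A | A \<subseteq> Q \<and> card A = 4 \<and> card (A \<inter> R) = r. g A)"
  proof (rule sum.reindex_bij_witness[where i = "\<lambda>A. (A \<inter> R, A - R)" and j = "\<lambda>(B, C). B \<union> C"])
    fix a assume a: "a \<in> {B. B \<subseteq> Q \<inter> R \<and> card B = r} \<times> {C. C \<subseteq> Q - R \<and> card C = 4 - r}"
    obtain B C where [simp]: "a = (B, C)" by (cases a)
    have "B \<inter> C = {}" "finite B" "finite C" using a assms(1) by (auto intro: finite_subset)
    then have "card (B \<union> C) = 4" using a assms(2) by (auto simp: card_Un_disjoint)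
    moreover have "(B \<union> C) \<inter> R = B" "(B \<union> C) - R = C" using a by auto
    ultimately show "((case a of (B, C) \<Rightarrow> B \<union> C) \<inter> R, (case a of (B, C) \<Rightarrow> B \<union> C) - R) = a"
      "(case a of (B, C) \<Rightarrow> B \<union> C) \<in> {A. A \<subseteq> Q \<and> card A = 4 \<and> card (A \<inter> R) = r}"
      using a by auto
  next
    fix A assume A: "A \<in> {A. A \<subseteq> Q \<and> card A = 4 \<and> card (A \<inter> R) = r}"
    have "card (A - R) = card A - card (A \<inter> R)"
      using A assms(1) by (intro card_Diff_subset_Int) (auto intro: finite_subset)
    then show "(A \<inter> R, A - R) \<in> {B. B \<subseteq> Q \<inter> R \<and> card B = r} \<times> {C. C \<subseteq> Q - R \<and> card C = 4 - r}"
      using A by auto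
  qed auto
  finally show ?thesis by simp
qed

section \<open>Summing block products over orderings of the positions\<close>

text \<open>The map \<open>x\<close> gives the index at each position. Positions, unlike index
  values, never repeat, so blocks can be sets of positions; the assumption says that
  \<open>T\<close> does not see the order within a block.\<close>

locale symmetric_weight =
  fixes T :: "'n list \<Rightarrow> real" and x :: "'a \<Rightarrow> 'n" and w :: "'a set \<Rightarrow> real"
  assumes weight: "\<And>l. distinct l \<Longrightarrow> length l = 4 \<Longrightarrow> T (map x l) = w (set l)"
begin

text \<open>Cutting an ordering of the rows and one of the columns into segments of the lengths
  given by \<open>s\<close> yields an ordered partition of types \<open>s\<close>. Each partition
  arises from r! (4 - r)! orderings per block of type \<open>r\<close>.\<close>

lemma sum_rows_cols_block_prod:
  assumes "finite Q" "set s \<subseteq> {..4}" "card (Q \<inter> R) = sum_list s" "card (Q - R) = (\<Sum>r\<leftarrow>s. 4 - r)"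
  shows "(\<Sum>l\<in>permutations_of_set (Q \<inter> R). \<Sum>l'\<in>permutations_of_set (Q - R).
            block_prod T s (map x l) (map x l'))
     = (\<Prod>r\<leftarrow>s. fact r * fact (4 - r)) * typed_partition_sum w R s Q"
  using assms
proof (induction s arbitrary: Q)
  case Nil
  then have "Q \<inter> R = {}" "Q - R = {}" by (auto simp del: Diff_eq_empty_iff)
  moreover from this have "Q = {}" by auto
  ultimately show ?case by simp
next
  case (Cons r s)
  have fin: "finite (Q \<inter> R)" "finite (Q - R)" using Cons.prems by auto
  let ?X = "{B. B \<subseteq> Q \<inter> R \<and> card B = r}" and ?Y = "{C. C \<subseteq> Q - R \<and> card C = 4 - r}"
  let ?f = "\<lambda>l1 l2 l1' l2'. T (map x (l1 @ l1')) * block_prod T s (map x l2) (map x l2')"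
  \<comment> \<open>The first block is split off in two cuts: first in the column ordering, under
    the sum over row orderings, then in the row ordering.\<close>
  have "(\<Sum>l\<in>permutations_of_set (Q \<inter> R). \<Sum>l'\<in>permutations_of_set (Q - R).
            block_prod T (r # s) (map x l) (map x l'))
      = (\<Sum>l\<in>permutations_of_set (Q \<inter> R). \<Sum>C\<in>?Y. \<Sum>l1'\<in>permutations_of_set C.
           \<Sum>l2'\<in>permutations_of_set (Q - R - C). ?f (take r l) (drop r l) l1' l2')"
  proof (rule sum.cong[OF refl])
    fix l
    show "(\<Sum>l'\<in>permutations_of_set (Q - R). block_prod T (r # s) (map x l) (map x l'))
        = (\<Sum>C\<in>?Y. \<Sum>l1'\<in>permutations_of_set C. \<Sum>l2'\<in>permutations_of_set (Q - R - C).
             ?f (take r l) (drop r l) l1' l2')"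
      using sum_permutations_of_set_split[OF fin(2), of "4 - r" "?f (take r l) (drop r l)"]
        Cons.prems(4) by (simp add: take_map drop_map)
  qed
  also have "\<dots> = (\<Sum>B\<in>?X. \<Sum>l1\<in>permutations_of_set B. \<Sum>l2\<in>permutations_of_set (Q \<inter> R - B).
       \<Sum>C\<in>?Y. \<Sum>l1'\<in>permutations_of_set C. \<Sum>l2'\<in>permutations_of_set (Q - R - C). ?f l1 l2 l1' l2')"
    by (rule sum_permutations_of_set_split) (use fin Cons.prems(3) in auto)
  also have "\<dots> = (\<Sum>B\<in>?X. \<Sum>C\<in>?Y. fact r * fact (4 - r) * (w (B \<union> C) *
       (\<Sum>l2\<in>permutations_of_set (Q \<inter> R - B). \<Sum>l2'\<in>permutations_of_set (Q - R - C).
          block_prod T s (map x l2) (map x l2'))))"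
  proof (rule sum.cong[OF refl])
    fix B assume B: "B \<in> ?X"
    let ?P = "permutations_of_set"
    \<comment> \<open>The factor \<open>T\<close> depends on \<open>C\<close>, \<open>l1\<close> and
      \<open>l1'\<close> only, so these sums are moved to the outside.\<close>
    have "(\<Sum>l1\<in>?P B. \<Sum>l2\<in>?P (Q \<inter> R - B). \<Sum>C\<in>?Y. \<Sum>l1'\<in>?P C. \<Sum>l2'\<in>?P (Q - R - C). ?f l1 l2 l1' l2')
       = (\<Sum>C\<in>?Y. \<Sum>l1\<in>?P B. \<Sum>l1'\<in>?P C. \<Sum>l2\<in>?P (Q \<inter> R - B). \<Sum>l2'\<in>?P (Q - R - C). ?f l1 l2 l1' l2')"
      by (subst (4) sum.swap, subst (3) sum.swap, subst (2) sum.swap, subst sum.swap,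
          intro sum.cong refl, subst sum.swap) (rule refl)
    also have "\<dots> = (\<Sum>C\<in>?Y. \<Sum>l1\<in>?P B. \<Sum>l1'\<in>?P C. w (B \<union> C) *
        (\<Sum>l2\<in>?P (Q \<inter> R - B). \<Sum>l2'\<in>?P (Q - R - C). block_prod T s (map x l2) (map x l2')))"
    proof (intro sum.cong refl)
      fix C l1 l1' assume C: "C \<in> ?Y" and l: "l1 \<in> ?P B" "l1' \<in> ?P C"
      have "T (map x (l1 @ l1')) = w (set (l1 @ l1'))"
      proof (rule weight)
        have "length l1 = r" "length l1' = 4 - r"
          using B C l by (auto dest!: length_finite_permutations_of_set)
        then show "length (l1 @ l1') = 4" using Cons.prems(2) by auto
      qed (use B C l in \<open>auto simp: permutations_of_set_def\<close>)
      also have "set (l1 @ l1') = B \<union> C" using l by (auto simp: permutations_of_set_def)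
      finally show "(\<Sum>l2\<in>?P (Q \<inter> R - B). \<Sum>l2'\<in>?P (Q - R - C). ?f l1 l2 l1' l2') = w (B \<union> C) *
        (\<Sum>l2\<in>?P (Q \<inter> R - B). \<Sum>l2'\<in>?P (Q - R - C). block_prod T s (map x l2) (map x l2'))"
        by (simp add: sum_distrib_left)
    qed
    \<comment> \<open>The summand no longer involves \<open>l1\<close> and \<open>l1'\<close>, which
      run over r! and (4 - r)! orderings.\<close>
    also have "\<dots> = (\<Sum>C\<in>?Y. fact r * fact (4 - r) * (w (B \<union> C) *
       (\<Sum>l2\<in>?P (Q \<inter> R - B). \<Sum>l2'\<in>?P (Q - R - C). block_prod T s (map x l2) (map x l2'))))"
    proof (rule sum.cong[OF refl])
      fix C assume C: "C \<in> ?Y"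
      have "finite B" "finite C" using B C Cons.prems(1) by (auto intro: finite_subset)
      then show "(\<Sum>l1\<in>?P B. \<Sum>l1'\<in>?P C. w (B \<union> C) *
        (\<Sum>l2\<in>?P (Q \<inter> R - B). \<Sum>l2'\<in>?P (Q - R - C). block_prod T s (map x l2) (map x l2')))
        = fact r * fact (4 - r) * (w (B \<union> C) *
       (\<Sum>l2\<in>?P (Q \<inter> R - B). \<Sum>l2'\<in>?P (Q - R - C). block_prod T s (map x l2) (map x l2')))"
        using B C by simp
    qed
    finally show "(\<Sum>l1\<in>?P B. \<Sum>l2\<in>?P (Q \<inter> R - B). \<Sum>C\<in>?Y. \<Sum>l1'\<in>?P C.
        \<Sum>l2'\<in>?P (Q - R - C). ?f l1 l2 l1' l2') = \<dots>" .
  qed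
  also have "\<dots> = (\<Sum>B\<in>?X. \<Sum>C\<in>?Y. fact r * fact (4 - r) * (w (B \<union> C) *
       ((\<Prod>r\<leftarrow>s. fact r * fact (4 - r)) * typed_partition_sum w R s (Q - (B \<union> C)))))"
  proof (intro sum.cong refl)
    fix B C assume B: "B \<in> ?X" and C: "C \<in> ?Y"
    \<comment> \<open>These are the row part and the column part of what remains, as the induction
      hypothesis needs them.\<close>
    have eq: "(Q - (B \<union> C)) \<inter> R = Q \<inter> R - B" "(Q - (B \<union> C)) - R = Q - R - C" using B C by auto
    have "(\<Sum>l\<in>permutations_of_set (Q \<inter> R - B). \<Sum>l'\<in>permutations_of_set (Q - R - C).
            block_prod T s (map x l) (map x l'))
       = (\<Prod>r\<leftarrow>s. fact r * fact (4 - r)) * typed_partition_sum w R s (Q - (B \<union> C))"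
    proof (subst eq[symmetric])+
      show "(\<Sum>l\<in>permutations_of_set ((Q - (B \<union> C)) \<inter> R).
          \<Sum>l'\<in>permutations_of_set ((Q - (B \<union> C)) - R). block_prod T s (map x l) (map x l'))
        = (\<Prod>r\<leftarrow>s. fact r * fact (4 - r)) * typed_partition_sum w R s (Q - (B \<union> C))"
      proof (rule Cons.IH)
        have "card (Q \<inter> R - B) = card (Q \<inter> R) - card B" "card (Q - R - C) = card (Q - R) - card C"
          by (intro card_Diff_subset; use B C Cons.prems(1) in \<open>auto intro: finite_subset\<close>)+
        then show "card ((Q - (B \<union> C)) \<inter> R) = sum_list s"
          "card (Q - (B \<union> C) - R) = (\<Sum>r\<leftarrow>s. 4 - r)"
          using B C Cons.prems by (auto simp: eq)
      qed (use Cons.prems in auto)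
    qed
    then show "fact r * fact (4 - r) * (w (B \<union> C) *
       (\<Sum>l2\<in>permutations_of_set (Q \<inter> R - B). \<Sum>l2'\<in>permutations_of_set (Q - R - C).
          block_prod T s (map x l2) (map x l2'))) = fact r * fact (4 - r) * (w (B \<union> C) *
       ((\<Prod>r\<leftarrow>s. fact r * fact (4 - r)) * typed_partition_sum w R s (Q - (B \<union> C))))" by simp
  qed
  also have "\<dots> = (\<Prod>r\<leftarrow>r # s. fact r * fact (4 - r)) *
      (\<Sum>B\<in>?X. \<Sum>C\<in>?Y. w (B \<union> C) * typed_partition_sum w R s (Q - (B \<union> C)))"
    by (simp add: sum_distrib_left mult_ac)
  also have "(\<Sum>B\<in>?X. \<Sum>C\<in>?Y. w (B \<union> C) * typed_partition_sum w R s (Q - (B \<union> C)))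
      = typed_partition_sum w R (r # s) Q"
    using sum_blocks_split[OF Cons.prems(1), of r] Cons.prems(2) by simp
  finally show ?case .
qed

text \<open>Here an ordering of all positions is cut in half, and each block takes two entries from
  either half. Every ordered partition arises from 4! orderings per block, whichever positions are
  rows.\<close>

lemma sum_all_block_prod:
  assumes "finite Q" "card Q = 4 * k"
  shows "(\<Sum>l\<in>permutations_of_set Q.
            block_prod T (replicate k 2) (map x (take (2 * k) l)) (map x (drop (2 * k) l)))
     = fact 4 ^ k * partition_sum w k Q"
  using assms
proof (induction k arbitrary: Q)
  case 0
  then show ?case by simp
next
  case (Suc k)
  let ?P = permutations_of_set
  \<comment> \<open>\<open>g 2\<close> brings the first two row and the first two column positions together at the front,
    and \<open>g (2 * k)\<close> undoes this\<close>
  define g where "g = (\<lambda>j (l :: 'a list). take 2 l @ take j (drop (2 + (2 * k + 2 - j)) l) @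
      take (2 * k + 2 - j) (drop 2 l) @ drop (2 * k + 4) l)"
  let ?F = "\<lambda>k l. block_prod T (replicate k 2) (map x (take (2 * k) l)) (map x (drop (2 * k) l))"
  have len: "length l = 4 * k + 4" if "l \<in> ?P Q" for l
    using length_finite_permutations_of_set[OF that] Suc.prems(2) by simp
  \<comment> \<open>With \<open>i = 2 * k\<close> this cuts a list before the rearrangement, with
    \<open>i = 2\<close> after it.\<close>
  have split: "\<exists>a b c d. l = a @ b @ c @ d \<and> length a = 2 \<and> length b = i \<and> length c = 2 * k + 2 - i \<and>
      length d = 2 * k" if "l \<in> ?P Q" "i \<le> 2 * k + 2" for l i
    using len[OF that(1)] that(2) by (intro list_split4) simp
  have "(\<Sum>l\<in>?P Q. ?F (Suc k) l) = (\<Sum>l\<in>?P Q. w (set (take 4 l)) * ?F k (drop 4 l))"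
  proof (rule sum.reindex_bij_witness[where i = "g (2 * k)" and j = "g 2"])
    fix l assume l: "l \<in> ?P Q"
    obtain a b c d where abcd: "l = a @ b @ c @ d" "length a = 2" "length b = 2 * k"
      "length c = 2" "length d = 2 * k" using split[OF l, of "2 * k"] by auto
    then have g: "g 2 l = a @ c @ b @ d" by (simp add: g_def)
    then show "g (2 * k) (g 2 l) = l" using abcd by (simp add: g_def)
    show "g 2 l \<in> ?P Q" using l abcd(1) g by (auto simp: permutations_of_set_def)
    have "T (map x (a @ c)) = w (set (a @ c))"
      using l abcd by (intro weight) (auto simp: permutations_of_set_def)
    then show "w (set (take 4 (g 2 l))) * ?F k (drop 4 (g 2 l)) = ?F (Suc k) l"
      unfolding g using abcd by simp
  next
    fix l assume l: "l \<in> ?P Q"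
    obtain a b c d where abcd: "l = a @ b @ c @ d" "length a = 2" "length b = 2"
      "length c = 2 * k" "length d = 2 * k" using split[OF l, of 2] by auto
    then have g: "g (2 * k) l = a @ c @ b @ d" by (simp add: g_def)
    then show "g 2 (g (2 * k) l) = l" using abcd by (simp add: g_def)
    show "g (2 * k) l \<in> ?P Q" using l abcd(1) g by (auto simp: permutations_of_set_def)
  qed
  also have "\<dots> = (\<Sum>A | A \<subseteq> Q \<and> card A = 4. \<Sum>l\<in>?P A. \<Sum>l'\<in>?P (Q - A). w (set l) * ?F k l')"
    using sum_permutations_of_set_split[OF Suc.prems(1), of 4 "\<lambda>l l'. w (set l) * ?F k l'"]
      Suc.prems(2) by simp
  also have "\<dots> = (\<Sum>A | A \<subseteq> Q \<and> card A = 4. fact 4 * (w A * (fact 4 ^ k * partition_sum w k (Q - A))))"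
  proof (rule sum.cong[OF refl])
    fix A assume A: "A \<in> {A. A \<subseteq> Q \<and> card A = 4}"
    then have "finite A" using Suc.prems(1) by (auto intro: finite_subset)
    then have "(\<Sum>l'\<in>?P (Q - A). ?F k l') = fact 4 ^ k * partition_sum w k (Q - A)"
      using A Suc.prems by (intro Suc.IH) (auto simp: card_Diff_subset)
    moreover have "(\<Sum>l\<in>?P A. \<Sum>l'\<in>?P (Q - A). w (set l) * ?F k l')
       = (\<Sum>l\<in>?P A. w A * (\<Sum>l'\<in>?P (Q - A). ?F k l'))"
      by (intro sum.cong refl) (simp add: permutations_of_set_def sum_distrib_left)
    ultimately show "(\<Sum>l\<in>?P A. \<Sum>l'\<in>?P (Q - A). w (set l) * ?F k l')
        = fact 4 * (w A * (fact 4 ^ k * partition_sum w k (Q - A)))"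
      using A \<open>finite A\<close> by simp
  qed
  also have "\<dots> = fact 4 ^ Suc k * partition_sum w (Suc k) Q"
    by (simp add: sum_distrib_left mult_ac)
  finally show ?case .
qed

end


section \<open>Kronecker products as block products\<close>

lemma tensor4_mset_cong:
  assumes "sos_symmetric4 M" "mset l = mset l'" "length l = 4"
  shows "tensor4 M l = tensor4 M l'"
proof -
  have list4: "\<exists>a b c d. xs = [a, b, c, d]" if "length xs = 4" for xs :: "'a list"
    using that by (auto simp: numeral_eq_Suc length_Suc_conv)
  have "length l' = 4" using assms(2,3) by (metis size_mset)
  then obtain a b c d a' b' c' d' where "l = [a, b, c, d]" "l' = [a', b', c', d']"
    using list4[OF assms(3)] list4 by blast
  then show ?thesis
    using assms(1)[unfolded sos_symmetric4_def, rule_format, of a b c d a' b' c' d'] assms(2)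
    by (simp add: tensor4_def)
qed

text \<open>Says that a matrix is a product of entries of \<open>T\<close>, one for each type in the
  list. Entries are compared only at tuples of the recorded arities, where they are
  meaningful.\<close>

definition has_blocks :: "('n list \<Rightarrow> real) \<Rightarrow> 'n tmat \<Rightarrow> nat list \<Rightarrow> bool" where
  "has_blocks T A s \<longleftrightarrow> row_len A = sum_list s \<and> col_len A = (\<Sum>r\<leftarrow>s. 4 - r) \<and>
     (\<forall>I J. length I = row_len A \<longrightarrow> length J = col_len A \<longrightarrow> entry A I J = block_prod T s I J)"

lemma block_prod_append:
  "block_prod T (s @ t) I J =
     block_prod T s (take (sum_list s) I) (take (\<Sum>r\<leftarrow>s. 4 - r) J) *
     block_prod T t (drop (sum_list s) I) (drop (\<Sum>r\<leftarrow>s. 4 - r) J)"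
  by (induction s arbitrary: I J) (simp_all add: take_drop min_def add.commute)

lemma has_blocks_kron:
  assumes "has_blocks T A s" "has_blocks T B t"
  shows "has_blocks T (A \<otimes>\<^sub>K B) (s @ t)"
  using assms by (simp add: has_blocks_def tm_kron_def block_prod_append)

lemma has_blocks_kron_power:
  assumes "has_blocks T A s"
  shows "has_blocks T (tm_kron_power A n) (concat (replicate n s))"
proof (induction n)
  case 0
  then show ?case by (simp add: has_blocks_def)
next
  case (Suc n)
  then show ?case using has_blocks_kron[OF assms Suc] by simp
qed

text \<open>Transposing exchanges the rows and columns of every block, so type \<open>r\<close>
  becomes \<open>4 - r\<close>; the symmetry of \<open>T\<close> restores the order of its
  arguments.\<close>

lemma has_blocks_transpose:
  assumes "has_blocks T A s" "set s \<subseteq> {..4}"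
    and sym: "\<And>l l'. length l + length l' = 4 \<Longrightarrow> T (l @ l') = T (l' @ l)"
  shows "has_blocks T (tm_transpose A) (map (\<lambda>r. 4 - r) s)"
proof -
  have "block_prod T s J I = block_prod T (map (\<lambda>r. 4 - r) s) I J"
    if "length J = sum_list s" "length I = (\<Sum>r\<leftarrow>s. 4 - r)" for I J
    using assms(2) that by (induction s arbitrary: I J) (auto simp: sym)
  moreover have "(\<Sum>r\<leftarrow>s. 4 - (4 - r)) = sum_list s"
    using assms(2) by (induction s) auto
  ultimately show ?thesis
    using assms(1) by (auto simp: has_blocks_def tm_transpose_def o_def)
qed

lemma has_blocks_unfold4:
  assumes "r \<le> 4"
  shows "has_blocks (tensor4 M) (unfold4 M r (4 - r)) [r]"
  using assms by (simp add: has_blocks_def unfold4_def)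

lemma has_blocks_M_A: "has_blocks (tensor4 M) (M_A M) [3, 0, 3]"
  using has_blocks_kron[OF has_blocks_unfold4[of 3] has_blocks_kron[OF has_blocks_unfold4[of 0] has_blocks_unfold4[of 3]]]
  by (simp add: M_A_def)

lemma has_blocks_M_B: "has_blocks (tensor4 M) (M_B M) [3, 1]"
  using has_blocks_kron[OF has_blocks_unfold4[of 3] has_blocks_unfold4[of 1]] by (simp add: M_B_def)

lemma has_blocks_M_C: "has_blocks (tensor4 M) (M_C M) [2]"
  by (auto simp: has_blocks_def M_C_def tensor4_def nth_append numeral_eq_Suc)

lemma has_blocks_M_D: "has_blocks (tensor4 M) (M_D M) [4, 0]"
  by (simp add: has_blocks_def M_D_def)

section \<open>Type counts of the expressions and the normalizing constant\<close>

text \<open>The types of the Kronecker factors in order: \<open>[3, 0, 3]\<close> for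
  \<open>M_A\<close>, \<open>[1, 4, 1]\<close> for its transpose, \<open>[3, 1]\<close> for
  \<open>M_B\<close>, \<open>2\<close> for \<open>M_C\<close> and \<open>[4, 0]\<close> for
  \<open>M_D\<close>.\<close>

fun block_types :: "frak \<Rightarrow> nat list" where
  "block_types (Frak a b c d) = concat (replicate a [3, 0, 3]) @ concat (replicate b [3, 1]) @
     replicate c 2 @ concat (replicate d [4, 0])"
| "block_types (FrakBar a b c d) = concat (replicate a [1, 4, 1]) @ concat (replicate b [3, 1]) @
     replicate c 2 @ concat (replicate d [4, 0])"

lemma prod_list_map_concat_replicate:
  "prod_list (map f (concat (replicate n s))) = prod_list (map f s) ^ n"
  for f :: "_ \<Rightarrow> 'b::comm_monoid_mult"
  by (induction n) simp_all

lemma sum_list_map_concat_replicate: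
  "sum_list (map f (concat (replicate n s))) = n * sum_list (map f s)" for f :: "_ \<Rightarrow> nat"
  by (induction n) simp_all

lemma count_mset_concat_replicate:
  "count (mset (concat (replicate n s))) i = n * count (mset s) i"
  by (induction n) simp_all

lemma length_concat_replicate: "length (concat (replicate n s)) = n * length s"
  by (induction n) simp_all

text \<open>\<open>M_A\<close> uses 12 indices, \<open>M_B\<close> and \<open>M_D\<close> use 8,
  \<open>M_C\<close> uses 4. In each of them half of the indices are rows, and there is one block
  per four indices.\<close>

lemma block_types_frak_set:
  assumes "X \<in> frak_set (4 * k)"
  shows "length (block_types X) = k" "sum_list (block_types X) = 2 * k"
    "(\<Sum>r\<leftarrow>block_types X. 4 - r) = 2 * k" "set (block_types X) \<subseteq> {..4}"
  using assms
  by (auto simp: frak_set_def length_concat_replicate sum_list_map_concat_replicate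
      sum_list_map_concat_replicate[of "\<lambda>r. r", simplified] sum_list_replicate map_replicate_const
      split: if_splits)

text \<open>The denominator is \<open>normR\<close>. For unbarred expressions the counts of types 0
  to 4 are \<open>a + d\<close>, \<open>b\<close>, \<open>c\<close>, \<open>2 * a + b\<close>,
  \<open>d\<close>, and barred ones have them in reverse. Types 1 and 3 carry a factor 3!, types 0
  and 4 a factor 4!, and type 2 a factor 2! 2!.\<close>

lemma entry_frak_core:
  assumes "sos_symmetric4 M"
    and "length I = sum_list (block_types X)" "length J = (\<Sum>r\<leftarrow>block_types X. 4 - r)"
  shows "entry (frak_core M X) I J = block_prod (tensor4 M) (block_types X) I J /
     ((\<Prod>i\<le>4. fact (count (mset (block_types X)) i)) * (\<Prod>r\<leftarrow>block_types X. fact r * fact (4 - r)))"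
    and "row_len (frak_core M X) = sum_list (block_types X)"
    and "col_len (frak_core M X) = (\<Sum>r\<leftarrow>block_types X. 4 - r)"
proof -
  let ?T = "tensor4 M"
  have sym: "?T (l @ l') = ?T (l' @ l)" if "length l + length l' = 4" for l l'
    using that by (intro tensor4_mset_cong[OF assms(1)]) auto
  have "has_blocks ?T (tm_transpose (M_A M)) [1, 4, 1]"
    using has_blocks_transpose[OF has_blocks_M_A, of M] sym by simp
  note intros = has_blocks_kron has_blocks_kron_power has_blocks_M_A has_blocks_M_B[simplified]
    has_blocks_kron_power[OF has_blocks_M_C, simplified] has_blocks_M_D this[simplified]
  have atMost4: "{..4::nat} = {0, 1, 2, 3, 4}" by auto
  \<comment> \<open>The \<open>c\<close> blocks of type 2 give (2! 2!)^c, evaluated to 4^c, whereas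
    \<open>normR\<close> has 2!^(2c).\<close>
  have four_power: "(4 :: real) ^ n = 2 ^ n * 2 ^ n" for n
    by (simp flip: power_mult_distrib)
  note simps = normR_def four_power mult_2 mult_2_right count_mset_concat_replicate prod_list_map_concat_replicate atMost4
    power_add power_mult_distrib algebra_simps
  obtain A a b c d where A: "frak_core M X = tm_scale (1 / normR a b c d) A"
    "has_blocks ?T A (block_types X)"
    and normR: "normR a b c d = (\<Prod>i\<le>4. fact (count (mset (block_types X)) i)) *
      (\<Prod>r\<leftarrow>block_types X. fact r * fact (4 - r))"
  proof (cases X)
    case (Frak a b c d)
    show thesis
    proof (rule that[of a b c d])
      show "normR a b c d = (\<Prod>i\<le>4. fact (count (mset (block_types X)) i)) *
          (\<Prod>r\<leftarrow>block_types X. fact r * fact (4 - r))"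
        by (simp add: Frak simps)
    qed (auto simp: Frak frakM_def intro!: intros)
  next
    case (FrakBar a b c d)
    show thesis
    proof (rule that[of a b c d])
      show "normR a b c d = (\<Prod>i\<le>4. fact (count (mset (block_types X)) i)) *
          (\<Prod>r\<leftarrow>block_types X. fact r * fact (4 - r))"
        by (simp add: FrakBar simps)
    qed (auto simp: FrakBar frakM_bar_def intro!: intros)
  qed
  then show "entry (frak_core M X) I J = block_prod (tensor4 M) (block_types X) I J /
     ((\<Prod>i\<le>4. fact (count (mset (block_types X)) i)) * (\<Prod>r\<leftarrow>block_types X. fact r * fact (4 - r)))"
    and "row_len (frak_core M X) = sum_list (block_types X)"
    and "col_len (frak_core M X) = (\<Sum>r\<leftarrow>block_types X. 4 - r)"
    using assms(2,3) by (auto simp: has_blocks_def tm_scale_def)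
qed

lemma
  assumes "set s \<subseteq> {..4::nat}"
  shows length_eq_sum_count: "length s = (\<Sum>i\<le>4. count (mset s) i)"
    and sum_list_eq_sum_count: "sum_list s = (\<Sum>i\<le>4. i * count (mset s) i)"
  using sum_list_map_eq_sum_count2[OF assms, of "\<lambda>_. 1"]
    sum_list_map_eq_sum_count2[OF assms, of "\<lambda>i. i"]
  by (simp_all add: sum_list_triv count_mset mult.commute)

lemma count_block_types:
  "count (mset (block_types (Frak a b c d))) i =
     (if i = 0 then a + d else if i = 1 then b else if i = 2 then c
      else if i = 3 then 2 * a + b else if i = 4 then d else 0)"
  "count (mset (block_types (FrakBar a b c d))) i =
     (if i = 0 then d else if i = 1 then 2 * a + b else if i = 2 then c
      else if i = 3 then b else if i = 4 then a + d else 0)"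
  by (simp_all add: count_mset_concat_replicate)

text \<open>The counts determine the parameters. They also determine the constructor: type 0 is at
  least as frequent as type 4 in an unbarred expression and strictly rarer in a barred one, since
  there \<open>a > 0\<close>.\<close>

lemma inj_on_mset_block_types: "inj_on (\<lambda>X. mset (block_types X)) (frak_set q)"
proof (rule inj_onI)
  fix X Y assume XY: "X \<in> frak_set q" "Y \<in> frak_set q"
    and "mset (block_types X) = mset (block_types Y)"
  then have eq: "count (mset (block_types X)) i = count (mset (block_types Y)) i" for i by simp
  show "X = Y"
    using eq[of 0] eq[of 1] eq[of 2] eq[of 3] eq[of 4] XY
    by (cases X; cases Y) (auto simp: count_block_types frak_set_def simp del: block_types.simps)
qed

text \<open>The two equations give 2 n_0 + n_1 = n_3 + 2 n_4, so the surplus of type 0 over type 4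
  fixes the surplus of type 3 over type 1 as twice as much. This is the ratio in which copies of
  \<open>M_A\<close> supply them.\<close>

lemma block_types_surj:
  assumes "set s \<subseteq> {..4}" "length s = k" "sum_list s = 2 * k"
  shows "\<exists>X\<in>frak_set (4 * k). mset (block_types X) = mset s"
proof -
  let ?c = "count (mset s)"
  have atMost4: "{..4::nat} = {0, 1, 2, 3, 4}" by auto
  have k: "k = ?c 0 + ?c 1 + ?c 2 + ?c 3 + ?c 4"
    using length_eq_sum_count[OF assms(1)] assms(2) by (simp add: atMost4)
  have k2: "2 * k = ?c 1 + 2 * ?c 2 + 3 * ?c 3 + 4 * ?c 4"
    using sum_list_eq_sum_count[OF assms(1)] assms(3) by (simp add: atMost4)
  have 0: "?c i = 0" if "i \<notin> {0, 1, 2, 3, 4}" for i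
    using that assms(1) atMost4 by (auto simp: count_eq_zero_iff)
  show ?thesis
  proof (cases "?c 4 \<le> ?c 0")
    case True
    let ?X = "Frak (?c 0 - ?c 4) (?c 1) (?c 2) (?c 4)"
    have "?X \<in> frak_set (4 * k)" using True k k2 by (auto simp: frak_set_def)
    moreover have "mset (block_types ?X) = mset s"
      using True k k2 0 by (intro multiset_eqI) (auto simp: count_block_types simp del: block_types.simps)
    ultimately show ?thesis by blast
  next
    case False
    \<comment> \<open>The mirror image: types 0 and 4 exchange roles, as do 1 and 3.\<close>
    let ?X = "FrakBar (?c 4 - ?c 0) (?c 3) (?c 2) (?c 0)"
    have "?X \<in> frak_set (4 * k)" using False k k2 by (auto simp: frak_set_def)
    moreover have "mset (block_types ?X) = mset s"
      using False k k2 0 by (intro multiset_eqI) (auto simp: count_block_types simp del: block_types.simps)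
    ultimately show ?thesis by blast
  qed
qed

section \<open>Conjugation by the sum of all permutation matrices\<close>

text \<open>Row \<open>I\<close> of each permutation matrix has a single nonzero entry, at the tuple
  \<open>I\<close> rearranged by the inverse of \<open>\<sigma>\<close>. Summing over all
  \<open>\<sigma>\<close> makes the inverse disappear.\<close>

lemma sum_perm_sum:
  fixes I :: "'n::finite list"
  assumes "length I = m"
  shows "(\<Sum>K | length K = m. entry (perm_sum m) I K * f K)
       = (\<Sum>\<sigma> | \<sigma> permutes {..<m}. (f (permute_list \<sigma> I) :: real))"
proof -
  have fin: "finite {K :: 'n list. length K = m}"
    using finite_lists_length_eq[of "UNIV :: 'n set" m] by simp
  have perm: "(\<Sum>K | length K = m. (if I = permute_list \<sigma> K then 1 else 0) * f K)
      = f (permute_list (inv \<sigma>) I)" if "\<sigma> permutes {..<m}" for \<sigma>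
  proof -
    have iff: "I = permute_list \<sigma> K \<longleftrightarrow> K = permute_list (inv \<sigma>) I" if "length K = m" for K
      using \<open>\<sigma> permutes {..<m}\<close> permutes_inv[OF \<open>\<sigma> permutes {..<m}\<close>] that assms
      by (metis permute_list_compose permute_list_id permutes_inv_o)
    have "(\<Sum>K | length K = m. (if I = permute_list \<sigma> K then 1 else 0) * f K)
        = (\<Sum>K | length K = m. if K = permute_list (inv \<sigma>) I then f K else 0)"
      by (rule sum.cong) (auto simp: iff)
    then show ?thesis using fin assms by simp
  qed
  have "(\<Sum>K | length K = m. entry (perm_sum m) I K * f K)
     = (\<Sum>\<sigma> | \<sigma> permutes {..<m}. \<Sum>K | length K = m. (if I = permute_list \<sigma> K then 1 else 0) * f K)"
    by (simp add: perm_sum_def perm_mat_def sum_distrib_right sum.swap[of _ "{K. length K = m}"])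
  also have "\<dots> = (\<Sum>\<sigma> | \<sigma> permutes {..<m}. f (permute_list (inv \<sigma>) I))"
    by (intro sum.cong refl perm) simp
  also have "\<dots> = (\<Sum>\<sigma> | \<sigma> permutes {..<m}. f (permute_list \<sigma> I))"
    by (rule sum_permutations_inverse[symmetric])
  finally show ?thesis .
qed

text \<open>The left factor permutes the row index and the right factor the column index,
  independently of each other.\<close>

lemma entry_perm_sum_conjugate:
  fixes I J :: "'n::finite list"
  assumes "row_len A = m" "col_len A = m" "length I = m" "length J = m"
  shows "entry (tm_mult (tm_mult (perm_sum m) A) (tm_transpose (perm_sum m))) I J
    = (\<Sum>\<sigma> | \<sigma> permutes {..<m}. \<Sum>\<tau> | \<tau> permutes {..<m}. entry A (permute_list \<sigma> I) (permute_list \<tau> J))"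
proof -
  have "entry (tm_mult (tm_mult (perm_sum m) A) (tm_transpose (perm_sum m))) I J
    = (\<Sum>L | length L = m. entry (perm_sum m) J L * (\<Sum>K | length K = m. entry (perm_sum m) I K * entry A K L))"
    using assms(2) by (simp add: tm_mult_def tm_transpose_def perm_sum_def mult.commute)
  also have "\<dots> = (\<Sum>\<tau> | \<tau> permutes {..<m}. \<Sum>\<sigma> | \<sigma> permutes {..<m}. entry A (permute_list \<sigma> I) (permute_list \<tau> J))"
    by (simp add: sum_perm_sum assms)
  finally show ?thesis by (subst sum.swap)
qed

text \<open>Passes from rearranged index tuples to orderings of positions: \<open>[i..<j]\<close>
  has no repetitions, even if \<open>x\<close> takes a value twice.\<close>

lemma sum_permutes_map:
  "(\<Sum>\<sigma> | \<sigma> permutes {..<j - i}. f (permute_list \<sigma> (map x [i..<j])))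
   = (\<Sum>l\<in>permutations_of_set {i..<j}. (f (map x l) :: real))"
  using sum_permutes_eq_sum_permutations_of_set[of "[i..<j]" "\<lambda>l. f (map x l)"]
  by (simp add: permute_list_map)

section \<open>Comparison of both sides with the sum over partitions\<close>

theorem theorem8p4:
  fixes M :: "real^('n::finite \<times> 'n)^('n \<times> 'n)" and q :: nat
  assumes "sos_symmetric4 M" and "4 dvd q"
  shows "\<forall>I J :: 'n list. length I = q div 2 \<longrightarrow> length J = q div 2 \<longrightarrow>
      fact (q div 4) * fact 4 ^ (q div 4) * (\<Sum>X\<in>frak_set q. entry (frak_mat M q X) I J)
        = (\<Sum>\<pi> | \<pi> permutes {..<q}. entry (tm_permute \<pi> (tm_kron_power (M_C M) (q div 4))) I J)
    \<and> (\<Sum>\<pi> | \<pi> permutes {..<q}. entry (tm_permute \<pi> (tm_kron_power (M_C M) (q div 4))) I J)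
        = fact q * entry (tm_symmetrize (tm_kron_power (M_C M) (q div 4))) I J"
proof (intro allI impI conjI)
  fix I J :: "'n list" assume IJ: "length I = q div 2" "length J = q div 2"
  obtain k where q: "q = 4 * k" using assms(2) by blast
  define T where "T = tensor4 M"
  define x where "x = (!) (I @ J)"
  \<comment> \<open>Sorting is just one choice of an order on \<open>A\<close>; by the symmetry of
    \<open>M\<close> every order gives the same value.\<close>
  define w where "w = (\<lambda>A. T (map x (sorted_list_of_set A)))"
  define Q R where "Q = {..<q}" and "R = {..<2 * k}"
  have len: "length I = 2 * k" "length J = 2 * k" using IJ q by simp_all
  interpret symmetric_weight T x w
  proof
    fix l :: "nat list" assume l: "distinct l" "length l = 4"
    then have "mset (sorted_list_of_set (set l)) = mset l"
      by (simp add: distinct_sorted_list_of_set set_eq_iff_mset_eq_distinct[symmetric])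
    then show "T (map x l) = w (set l)"
      unfolding T_def w_def using l(2) by (intro tensor4_mset_cong[OF assms(1)]) simp_all
  qed
  have I: "I = map x [0..<2 * k]" and J: "J = map x [2 * k..<4 * k]"
    and IJ': "I @ J = map x [0..<4 * k]"
    using len by (auto simp: x_def nth_append intro: nth_equalityI)
  have QR: "Q \<inter> R = {0..<2 * k}" "Q - R = {2 * k..<4 * k}"
    by (auto simp: Q_def R_def q)
  let ?B = "tm_kron_power (M_C M) k"
  have blocks: "has_blocks T ?B (replicate k 2)"
    using has_blocks_kron_power[OF has_blocks_M_C, of M k] by (simp add: T_def)
  have dims: "row_len ?B = 2 * k" "col_len ?B = 2 * k"
    using blocks by (simp_all add: has_blocks_def sum_list_replicate)
  \<comment> \<open>The permutation side is evaluated first.\<close>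
  have "(\<Sum>\<pi> | \<pi> permutes {..<q}. entry (tm_permute \<pi> ?B) I J)
      = (\<Sum>\<pi> | \<pi> permutes {..<4 * k - 0}.
           (\<lambda>K. entry ?B (take (2 * k) K) (drop (2 * k) K)) (permute_list \<pi> (map x [0..<4 * k])))"
    by (simp add: tm_permute_def dims IJ' q Let_def)
  also have "\<dots> = (\<Sum>l\<in>permutations_of_set Q. entry ?B (take (2 * k) (map x l)) (drop (2 * k) (map x l)))"
    by (subst sum_permutes_map) (simp add: Q_def q atLeast0LessThan)
  also have "\<dots> = (\<Sum>l\<in>permutations_of_set Q.
      block_prod T (replicate k 2) (map x (take (2 * k) l)) (map x (drop (2 * k) l)))"
  proof (rule sum.cong[OF refl])
    fix l assume "l \<in> permutations_of_set Q"
    then have "length l = 4 * k" using length_finite_permutations_of_set by (force simp: Q_def q)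
    then show "entry ?B (take (2 * k) (map x l)) (drop (2 * k) (map x l)) =
        block_prod T (replicate k 2) (map x (take (2 * k) l)) (map x (drop (2 * k) l))"
      using blocks dims by (simp add: has_blocks_def take_map drop_map sum_list_replicate)
  qed
  also have "\<dots> = fact 4 ^ k * partition_sum w k Q"
    by (rule sum_all_block_prod) (simp_all add: Q_def q)
  finally have rhs: "(\<Sum>\<pi> | \<pi> permutes {..<q}. entry (tm_permute \<pi> ?B) I J)
      = fact 4 ^ k * partition_sum w k Q" .

  let ?E = "\<lambda>s. typed_partition_sum w R s Q"
  let ?P = "\<lambda>X. permutations_of_multiset (mset (block_types X))"
  let ?L = "{s. set s \<subseteq> {..4::nat} \<and> length s = k}"
  have finL: "finite ?L" by (rule finite_lists_length_eq) simp
  \<comment> \<open>The entry is \<open>?E\<close> at the types of \<open>X\<close>, divided by the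
    product of the factorials of the type counts. Multiplying by k! leaves the number of
    arrangements of these types as coefficient, and each arrangement has the same
    \<open>?E\<close>.\<close>
  have entry: "fact k * entry (frak_mat M q X) I J = (\<Sum>s\<in>?P X. ?E s)" if X: "X \<in> frak_set q" for X
  proof -
    let ?s = "block_types X"
    let ?cnt = "(\<Prod>i\<le>4. fact (count (mset ?s) i)) :: real"
      and ?fac = "(\<Prod>r\<leftarrow>?s. fact r * fact (4 - r)) :: real"
    note s = block_types_frak_set[OF X[unfolded q]]
    note core = entry_frak_core[OF assms(1), where X = X, unfolded s]
    have cols: "(\<Sum>\<tau> | \<tau> permutes {..<2 * k}. block_prod T ?s K (permute_list \<tau> J))
        = (\<Sum>l'\<in>permutations_of_set (Q - R). block_prod T ?s K (map x l'))" for K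
      using sum_permutes_map[where i = "2 * k" and j = "4 * k" and x = x and f = "block_prod T ?s K"] by (simp add: QR J)
    have "entry (frak_mat M q X) I J = (\<Sum>\<sigma> | \<sigma> permutes {..<2 * k}. \<Sum>\<tau> | \<tau> permutes {..<2 * k}.
        entry (frak_core M X) (permute_list \<sigma> I) (permute_list \<tau> J))"
      using entry_perm_sum_conjugate[of "frak_core M X" "2 * k" I J] core(2,3) len
      by (simp add: frak_mat_def q)
    also have "\<dots> = (\<Sum>\<sigma> | \<sigma> permutes {..<2 * k}. \<Sum>\<tau> | \<tau> permutes {..<2 * k}.
        block_prod T ?s (permute_list \<sigma> I) (permute_list \<tau> J)) / (?cnt * ?fac)"
      using core(1) len by (simp add: T_def sum_divide_distrib)
    also have "(\<Sum>\<sigma> | \<sigma> permutes {..<2 * k}. \<Sum>\<tau> | \<tau> permutes {..<2 * k}.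
        block_prod T ?s (permute_list \<sigma> I) (permute_list \<tau> J))
      = (\<Sum>l\<in>permutations_of_set (Q \<inter> R). \<Sum>l'\<in>permutations_of_set (Q - R).
            block_prod T ?s (map x l) (map x l'))"
      unfolding cols
      using sum_permutes_map[where i = 0 and j = "2 * k" and x = x
          and f = "\<lambda>K. \<Sum>l'\<in>permutations_of_set (Q - R). block_prod T ?s K (map x l')"]
      by (simp add: QR(1) I)
    also have "\<dots> = ?fac * ?E ?s"
      by (rule sum_rows_cols_block_prod) (use s in \<open>simp_all add: QR\<close>, simp add: Q_def)
    finally have e: "entry (frak_mat M q X) I J = ?fac * ?E ?s / (?cnt * ?fac)" .
    \<comment> \<open>The orderings within blocks cancel against the matching factor of
      \<open>normR\<close>.\<close>
    have "?fac \<noteq> 0" by (simp add: prod_list_zero_iff image_iff)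
    then have e: "entry (frak_mat M q X) I J = ?E ?s / ?cnt" using e by simp
    \<comment> \<open>Types that do not occur contribute 0! = 1.\<close>
    have "(\<Prod>i\<in>set ?s. fact (count (mset ?s) i)) = (\<Prod>i\<le>4. fact (count (mset ?s) i) :: nat)"
      using s(4) by (intro prod.mono_neutral_left) (auto simp: count_eq_zero_iff[THEN iffD2])
    then have "card (?P X) * (\<Prod>i\<le>4. fact (count (mset ?s) i)) = (fact k :: nat)"
      using card_permutations_of_multiset_aux[of "mset ?s"] s(1) by simp
    from arg_cong[OF this, of real] have "real (card (?P X)) * ?cnt = fact k"
      by simp
    then have "fact k * entry (frak_mat M q X) I J = real (card (?P X)) * ?E ?s"
      unfolding e by (simp flip: \<open>real (card (?P X)) * ?cnt = fact k\<close>)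
    also have "\<dots> = (\<Sum>s\<in>?P X. ?E ?s)" by simp
    also have "\<dots> = (\<Sum>s\<in>?P X. ?E s)"
      by (intro sum.cong refl typed_partition_sum_mset_cong) (simp_all add: Q_def permutations_of_multiset_def)
    finally show ?thesis .
  qed
  \<comment> \<open>Finiteness of the set of expressions: it injects into the multisets of the
    finitely many type sequences of length \<open>k\<close>.\<close>
  have image: "(\<lambda>X. mset (block_types X)) ` frak_set q \<subseteq> mset ` ?L"
    using block_types_frak_set(1,4) q by blast
  have finX: "finite (frak_set q)"
    using finite_subset[OF image finite_imageI[OF finL]] inj_on_mset_block_types by (rule finite_imageD)
  have Un: "(\<Union>X\<in>frak_set q. ?P X) = {s \<in> ?L. sum_list s = 2 * k}"
  proof (intro set_eqI iffI)
    fix s assume "s \<in> (\<Union>X\<in>frak_set q. ?P X)"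
    then obtain X where X: "X \<in> frak_set q" "mset s = mset (block_types X)"
      by (auto simp: permutations_of_multiset_def)
    show "s \<in> {s \<in> ?L. sum_list s = 2 * k}"
      using block_types_frak_set[OF X(1)[unfolded q]] X(2) mset_eq_setD[OF X(2)]
        mset_eq_length[OF X(2)] by (metis (mono_tags, lifting) mem_Collect_eq sum_mset_sum_list)
  next
    fix s assume "s \<in> {s \<in> ?L. sum_list s = 2 * k}"
    then show "s \<in> (\<Union>X\<in>frak_set q. ?P X)"
      using block_types_surj[of s k] q by (fastforce simp: permutations_of_multiset_def)
  qed
  have "fact k * (\<Sum>X\<in>frak_set q. entry (frak_mat M q X) I J) = (\<Sum>X\<in>frak_set q. \<Sum>s\<in>?P X. ?E s)"
    by (simp add: sum_distrib_left entry)
  also have "\<dots> = (\<Sum>s\<in>(\<Union>X\<in>frak_set q. ?P X). ?E s)"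
    using inj_on_mset_block_types[of q] finX
    by (intro sum.UNION_disjoint[symmetric])
      (auto dest!: permutations_of_multisetD simp: inj_on_def)
  \<comment> \<open>The added sequences do not sum to \<open>2 * k\<close>, the number of row
    positions, so they contribute 0.\<close>
  also have "\<dots> = (\<Sum>s\<in>?L. ?E s)"
    unfolding Un using finL
    by (intro sum.mono_neutral_left) (auto intro!: typed_partition_sum_eq_0 simp: QR(1), auto simp: Q_def)
  also have "\<dots> = partition_sum w k Q"
    by (rule partition_sum_eq_sum_typed[symmetric]) (simp add: Q_def)
  finally show "fact (q div 4) * fact 4 ^ (q div 4) * (\<Sum>X\<in>frak_set q. entry (frak_mat M q X) I J)
        = (\<Sum>\<pi> | \<pi> permutes {..<q}. entry (tm_permute \<pi> (tm_kron_power (M_C M) (q div 4))) I J)"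
    using rhs by (simp add: q mult_ac)
  show "(\<Sum>\<pi> | \<pi> permutes {..<q}. entry (tm_permute \<pi> (tm_kron_power (M_C M) (q div 4))) I J)
        = fact q * entry (tm_symmetrize (tm_kron_power (M_C M) (q div 4))) I J"
    using dims by (simp add: tm_symmetrize_def q)
qed

end
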